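(* Let $h\geq 2$, $m$, $n$, $\lambda$ be positive integers with $n>\frac{m-1}{1-2^{\frac{1}{1-h}}}+h-1$, and let $\mathbf{r}=(r_1,\ldots,r_k)$ be a tuple of nonnegative integers. Regard $\lambda K_m^h$ as the subhypergraph of $\lambda K_n^h$ induced on a fixed $m$-subset of the $n$ vertices. Then every partial $\mathbf{r}$-factorization of $\lambda K_m^h$ can be extended to an $\mathbf{r}$-factorization of $\lambda K_n^h$ if and only if $(n,h,\lambda,\mathbf{r})$ is admissible, i.e. $h\mid r_j n$ for every $j\in[1,k]$ and $\sum_{j=1}^k r_j=\lambda\binom{n-1}{h-1}$.
   Context: A hypergraph $\mathcal G=(V,E)$ has vertex set $V$ and an edge multiset $E$ of nonempty subsets of $V$. The degree of a vertex $x$ is the number of edges (counted with multiplicity) containing $x$; $\mathcal G$ is $r$-regular if every vertex has degree exactly $r$. $\lambda K_n^h$ is the hypergraph on $n$ vertices whose edge multiset consists of every $h$-subset of the vertex set, each occurring exactly $\lambda$ times. For integers $a\le b$, $[a,b]$ denotes $\{a,a+1,\ldots,b\}$. A $k$-edge-coloring of $\mathcal G$ is a map $f:E\to[1,k]$ (assigning a color to each copy of each edge); it is extended to a $k$-edge-coloring $g$ of a hypergraph $\mathcal H\supseteq\mathcal G$ if $g(e)=f(e)$ for every edge $e$ of $\mathcal G$. For $\mathbf r=(r_1,\ldots,r_k)$, an $\mathbf r$-factorization of $\mathcal G$ is a $k$-edge-coloring such that for each $j\in[1,k]$ the edges of color $j$ form an $r_j$-regular spanning subhypergraph of $\mathcal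 G$. A partial $\mathbf r$-factorization of $\mathcal G$ is a $k$-edge-coloring of $\mathcal G$ such that for each $j\in[1,k]$ every vertex lies in at most $r_j$ edges of color $j$. *)

theory Defs
  imports Complex_Main "HOL-Library.Multiset" "HOL-Library.FuncSet"
begin

record 'a hypergraph =
  verts :: "'a set"
  edges :: "'a set multiset"

definition is_hypergraph :: "'a hypergraph \<Rightarrow> bool" where
  "is_hypergraph G \<longleftrightarrow> (\<forall>e \<in># edges G. e \<noteq> {} \<and> e \<subseteq> verts G)"

definition degree :: "'a hypergraph \<Rightarrow> 'a \<Rightarrow> nat" where
  "degree G x = size {#e \<in># edges G. x \<in> e#}"

definition regular :: "'a hypergraph \<Rightarrow> nat \<Rightarrow> bool" where
  "regular G d \<longleftrightarrow> (\<forall>x \<in> verts G. degree G x = d)"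

definition subhypergraph :: "'a hypergraph \<Rightarrow> 'a hypergraph \<Rightarrow> bool" where
  "subhypergraph G H \<longleftrightarrow> verts G \<subseteq> verts H \<and> edges G \<subseteq># edges H"

definition induced_subhypergraph :: "'a hypergraph \<Rightarrow> 'a set \<Rightarrow> 'a hypergraph" where
  "induced_subhypergraph G W = \<lparr>verts = W, edges = {#e \<in># edges G. e \<subseteq> W#}\<rparr>"

text \<open>The hypergraph $\lambda K_n^h$ on a given finite vertex set \<open>V\<close> with \<open>n\<close> elements.\<close>

definition complete_hypergraph :: "nat \<Rightarrow> nat \<Rightarrow> 'a set \<Rightarrow> 'a hypergraph" where
  "complete_hypergraph l h V =
     \<lparr>verts = V, edges = repeat_mset l (mset_set {e. e \<subseteq> V \<and> card e = h})\<rparr>"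

text \<open>The copies of an edge \<open>e\<close> of multiplicity \<open>p\<close> are the pairs \<open>(e, 0), \<dots>, (e, p - 1)\<close>.
  Hence the copies of the edges of a subhypergraph are also copies of edges of the larger
  hypergraph, and colorings of the two can be compared directly.\<close>

definition edge_copies :: "'a hypergraph \<Rightarrow> ('a set \<times> nat) set" where
  "edge_copies G = {(e, i). i < count (edges G) e}"

definition edge_coloring :: "nat \<Rightarrow> 'a hypergraph \<Rightarrow> ('a set \<times> nat \<Rightarrow> nat) \<Rightarrow> bool" where
  "edge_coloring k G f \<longleftrightarrow> f \<in> edge_copies G \<rightarrow> {1..k}"

definition color_class :: "'a hypergraph \<Rightarrow> ('a set \<times> nat \<Rightarrow> nat) \<Rightarrow> nat \<Rightarrow> 'a hypergraph" where
  "color_class G f j =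
     \<lparr>verts = verts G, edges = image_mset fst (mset_set {c \<in> edge_copies G. f c = j})\<rparr>"

definition extends_coloring ::
  "'a hypergraph \<Rightarrow> ('a set \<times> nat \<Rightarrow> nat) \<Rightarrow> 'a hypergraph \<Rightarrow> ('a set \<times> nat \<Rightarrow> nat) \<Rightarrow> bool" where
  "extends_coloring H g G f \<longleftrightarrow> subhypergraph G H \<and> (\<forall>c \<in> edge_copies G. g c = f c)"

text \<open>A tuple $(r_1,\dots,r_k)$ is given by \<open>k\<close> and a function \<open>r\<close>, of which only the values on
  \<open>{1..k}\<close> matter.\<close>

definition factorization ::
  "nat \<Rightarrow> (nat \<Rightarrow> nat) \<Rightarrow> 'a hypergraph \<Rightarrow> ('a set \<times> nat \<Rightarrow> nat) \<Rightarrow> bool" where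
  "factorization k r G f \<longleftrightarrow>
     edge_coloring k G f \<and> (\<forall>j \<in> {1..k}. regular (color_class G f j) (r j))"

definition partial_factorization ::
  "nat \<Rightarrow> (nat \<Rightarrow> nat) \<Rightarrow> 'a hypergraph \<Rightarrow> ('a set \<times> nat \<Rightarrow> nat) \<Rightarrow> bool" where
  "partial_factorization k r G f \<longleftrightarrow>
     edge_coloring k G f \<and> (\<forall>j \<in> {1..k}. \<forall>x \<in> verts G. degree (color_class G f j) x \<le> r j)"

definition admissible :: "nat \<Rightarrow> nat \<Rightarrow> nat \<Rightarrow> nat \<Rightarrow> (nat \<Rightarrow> nat) \<Rightarrow> bool" where
  "admissible n h l k r \<longleftrightarrow>
     (\<forall>j \<in> {1..k}. h dvd r j * n) \<and> (\<Sum>j = 1..k. r j) = l * ((n - 1) choose (h - 1))"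

lemma count_complete_hypergraph:
  assumes "finite V"
  shows "count (edges (complete_hypergraph l h V)) e = (if e \<subseteq> V \<and> card e = h then l else 0)"
proof -
  have "finite {e. e \<subseteq> V \<and> card e = h}"
    using assms by simp
  then show ?thesis
    by (simp add: complete_hypergraph_def count_mset_set')
qed

lemma is_hypergraph_complete:
  assumes "finite V" "h \<ge> 1"
  shows "is_hypergraph (complete_hypergraph l h V)"
  unfolding is_hypergraph_def
proof
  fix e
  assume "e \<in># edges (complete_hypergraph l h V)"
  then have "e \<subseteq> V \<and> card e = h"
    using count_complete_hypergraph[OF assms(1), of l h e]
    by (metis not_in_iff)
  then show "e \<noteq> {} \<and> e \<subseteq> verts (complete_hypergraph l h V)"
    using assms(2) by (auto simp: complete_hypergraph_def)
qed

lemma induced_subhypergraph_complete: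
  assumes "finite V" "W \<subseteq> V"
  shows "induced_subhypergraph (complete_hypergraph l h V) W = complete_hypergraph l h W"
proof -
  have "finite W"
    using assms finite_subset by blast
  have "edges (induced_subhypergraph (complete_hypergraph l h V) W)
      = edges (complete_hypergraph l h W)"
    using assms \<open>finite W\<close>
    by (intro multiset_eqI) (auto simp: induced_subhypergraph_def count_complete_hypergraph)
  moreover have "verts (induced_subhypergraph (complete_hypergraph l h V) W)
      = verts (complete_hypergraph l h W)"
    by (simp add: induced_subhypergraph_def complete_hypergraph_def)
  ultimately show ?thesis
    by simp
qed

lemma subhypergraph_complete:
  assumes "finite V" "W \<subseteq> V"
  shows "subhypergraph (complete_hypergraph l h W) (complete_hypergraph l h V)"
  unfolding induced_subhypergraph_complete[OF assms, symmetric]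
  using assms by (simp add: subhypergraph_def induced_subhypergraph_def complete_hypergraph_def)

end

theory Submission
  imports Defs "HOL-Library.Transitive_Closure_Table"
begin

text \<open>
  Identify all vertices outside \<open>W\<close>, so that an edge is only known through its trace on \<open>W\<close>.
  Color the traces of sizes \<open>h - 1, \<dots>, 1\<close> greedily, in this order. A trace \<open>X\<close> of size
  \<open>i\<close> is blocked only if the colored degrees of its vertices add up to \<open>\<Sum>j. r j\<close>. The bound on \<open>n\<close>
  says that at most half of the edges at a vertex of \<open>W\<close> meet \<open>W\<close> again, and from there on the number
  of edges at a vertex by trace size at least halves with each further size, so the
  edges of trace size at least \<open>i\<close> at a vertex make up at most a fraction \<open>1 / i\<close> and no trace is
  blocked. The edges avoiding \<open>W\<close> absorb the rest, as \<open>n \<ge> h m\<close>.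

  Then the vertices outside \<open>W\<close> are split off one at a time (Baranyai's argument): with \<open>s\<close> vertices
  still identified, giving the new vertex the fraction \<open>(h - |X|) / s\<close> of the edges with trace \<open>X\<close> in
  each color meets all requirements, and this fractional matrix has integral row and
  column sums, so it can be replaced by an integral one.
\<close>

subsection \<open>Sums over subsets\<close>

lemma sum_Pow_card:
  fixes \<phi> :: "nat \<Rightarrow> nat"
  assumes "finite A"
  shows "(\<Sum>X\<in>Pow A. \<phi> (card X)) = (\<Sum>t\<le>card A. (card A choose t) * \<phi> t)"
proof -
  have "(\<Sum>X\<in>Pow A. \<phi> (card X)) = (\<Sum>t\<le>card A. \<Sum>X\<in>{X \<in> Pow A. card X = t}. \<phi> (card X))"
    using assms by (intro sum.group[symmetric]) (auto simp: card_mono)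
  also have "\<dots> = (\<Sum>t\<le>card A. (card A choose t) * \<phi> t)"
    using n_subsets[OF assms] by (intro sum.cong) (auto simp: Pow_def)
  finally show ?thesis .
qed

lemma sum_subsets_containing:
  assumes "x \<in> A"
  shows "(\<Sum>X | X \<subseteq> A \<and> x \<in> X. g X) = (\<Sum>X\<in>Pow (A - {x}). g (insert x X))"
  by (rule sum.reindex_bij_witness[of _ "insert x" "\<lambda>X. X - {x}"])
    (use assms in \<open>auto simp: insert_absorb\<close>)

lemma sum_Pow_insert:
  assumes "finite A" "x \<notin> A"
  shows "(\<Sum>X\<in>Pow (insert x A). g X) = (\<Sum>X\<in>Pow A. g X) + (\<Sum>X\<in>Pow A. g (insert x X))"
proof -
  have "inj_on (insert x) (Pow A)"
    using assms(2) by (auto simp: inj_on_def)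
  moreover have "Pow A \<inter> insert x ` Pow A = {}"
    using assms(2) by auto
  ultimately show ?thesis
    using assms(1) by (simp add: Pow_insert sum.union_disjoint sum.reindex)
qed

text \<open>Double counting of incidences between vertices and sets weighted by
  \<open>c\<close>.\<close>

lemma sum_degrees:
  fixes c :: "'a set \<Rightarrow> nat"
  assumes "finite A"
  shows "(\<Sum>x\<in>A. \<Sum>X | X \<subseteq> A \<and> x \<in> X. c X) = (\<Sum>X\<in>Pow A. card X * c X)"
proof -
  have "(\<Sum>x\<in>A. \<Sum>X | X \<subseteq> A \<and> x \<in> X. c X) = (\<Sum>x\<in>A. \<Sum>X\<in>{X \<in> Pow A. x \<in> X}. c X)"
    by simp
  also have "\<dots> = (\<Sum>X\<in>Pow A. \<Sum>x\<in>{x \<in> A. x \<in> X}. c X)"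
    using assms by (intro sum.swap_restrict) auto
  also have "\<dots> = (\<Sum>X\<in>Pow A. card X * c X)"
  proof (rule sum.cong)
    fix X assume "X \<in> Pow A"
    then have "{x \<in> A. x \<in> X} = X" by auto
    then show "(\<Sum>x\<in>{x \<in> A. x \<in> X}. c X) = card X * c X" by simp
  qed simp
  finally show ?thesis .
qed

subsection \<open>Integral transportation\<close>

text \<open>Supplies the rows of the starting matrix in \<open>integral_transport\<close>; filling
  the entries greedily suffices.\<close>

lemma exists_bounded_with_sum:
  fixes c :: "'a \<Rightarrow> nat"
  assumes "finite B" "R \<le> (\<Sum>b\<in>B. c b)"
  shows "\<exists>d. (\<forall>b\<in>B. d b \<le> c b) \<and> (\<Sum>b\<in>B. d b) = R"
  using assms
proof (induction B arbitrary: R rule: finite_induct)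
  case (insert b B)
  then have "R - min R (c b) \<le> (\<Sum>b\<in>B. c b)" by auto
  with insert.IH obtain d where d: "\<forall>b\<in>B. d b \<le> c b" "(\<Sum>b\<in>B. d b) = R - min R (c b)" by blast
  have "(\<Sum>b'\<in>B. (d(b := min R (c b))) b') = (\<Sum>b\<in>B. d b)"
    using insert.hyps by (intro sum.cong) auto
  with d insert.hyps show ?case
    by (intro exI[of _ "d(b := min R (c b))"]) auto
qed simp

text \<open>Lets the rest of an augmenting path survive after a unit has been moved at its
  start.\<close>

lemma rtrancl_path_restrict:
  assumes "rtrancl_path r x p y"
    and "\<And>z w. z \<in> set (x # p) \<Longrightarrow> w \<in> set p \<Longrightarrow> r z w \<Longrightarrow> r' z w"
  shows "rtrancl_path r' x p y"
  using assms by (induction rule: rtrancl_path.induct) (auto intro: rtrancl_path.intros)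

text \<open>A path step from \<open>b\<close> to \<open>b'\<close> means that some row can shift a
  unit from column \<open>b\<close> to column \<open>b'\<close>. Shifting along the whole path keeps
  all row sums, and intermediate columns gain and lose one unit. The \<open>of_bool\<close> terms
  avoid subtraction and also cover the empty path.\<close>

lemma augmenting_path:
  fixes d c :: "'a \<Rightarrow> 'b \<Rightarrow> nat"
  assumes "finite A" "finite B"
    and "rtrancl_path (\<lambda>b b'. \<exists>a\<in>A. 0 < d a b \<and> d a b' < c a b') b p b'"
    and "distinct (b # p)" "set (b # p) \<subseteq> B"
    and "\<forall>a\<in>A. \<forall>b\<in>B. d a b \<le> c a b"
  shows "\<exists>d'. (\<forall>a\<in>A. \<forall>b\<in>B. d' a b \<le> c a b) \<and> (\<forall>a\<in>A. (\<Sum>b\<in>B. d' a b) = (\<Sum>b\<in>B. d a b)) \<and>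
    (\<forall>z\<in>B. (\<Sum>a\<in>A. d' a z) + of_bool (z = b) = (\<Sum>a\<in>A. d a z) + of_bool (z = b'))"
  using assms(3-)
proof (induction p arbitrary: d b)
  case Nil
  then have "b' = b" by (auto elim: rtrancl_path.cases)
  with Nil show ?case by blast
next
  case (Cons y p)
  from Cons.prems(1) obtain a where a: "a \<in> A" "0 < d a b" "d a y < c a y"
    and path: "rtrancl_path (\<lambda>b b'. \<exists>a\<in>A. 0 < d a b \<and> d a b' < c a b') y p b'"
    by (auto elim: rtrancl_path.cases)
  have bB: "b \<in> B" "y \<in> B" "b \<noteq> y" using Cons.prems by auto
  define d1 where "d1 = (\<lambda>a' z. if a' = a \<and> z = b then d a b - 1
    else if a' = a \<and> z = y then d a y + 1 else d a' z)"
  \<comment> \<open>By distinctness the rest never returns to column \<open>b\<close>, and column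
    \<open>y\<close> occurs only as a source, where the added unit does no harm.\<close>
  have "rtrancl_path (\<lambda>b b'. \<exists>a\<in>A. 0 < d1 a b \<and> d1 a b' < c a b') y p b'"
    using path
  proof (rule rtrancl_path_restrict)
    fix z w assume "z \<in> set (y # p)" "w \<in> set p" and ex: "\<exists>a\<in>A. 0 < d a z \<and> d a w < c a w"
    then have "z \<noteq> b" "w \<noteq> b" "w \<noteq> y" using Cons.prems(2) by auto
    with ex show "\<exists>a\<in>A. 0 < d1 a z \<and> d1 a w < c a w" by (auto simp: d1_def)
  qed
  moreover have "\<forall>a\<in>A. \<forall>b\<in>B. d1 a b \<le> c a b"
    using Cons.prems(4) a by (auto simp: d1_def intro: diff_le_self[THEN order_trans])
  ultimately obtain d' where d': "\<forall>a\<in>A. \<forall>b\<in>B. d' a b \<le> c a b"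
      "\<forall>a\<in>A. (\<Sum>b\<in>B. d' a b) = (\<Sum>b\<in>B. d1 a b)"
      "\<forall>z\<in>B. (\<Sum>a\<in>A. d' a z) + of_bool (z = y) = (\<Sum>a\<in>A. d1 a z) + of_bool (z = b')"
    using Cons.IH[of d1 y] Cons.prems(2,3) by auto
  have row: "(\<Sum>z\<in>B. d1 a' z) = (\<Sum>z\<in>B. d a' z)" if "a' \<in> A" for a'
  proof -
    have eq: "d1 a' z + of_bool (a' = a \<and> z = b) = d a' z + of_bool (a' = a \<and> z = y)" for z
      using a bB by (auto simp: d1_def)
    have "(\<Sum>z\<in>B. d1 a' z) + (\<Sum>z\<in>B. of_bool (a' = a \<and> z = b))
      = (\<Sum>z\<in>B. d a' z) + (\<Sum>z\<in>B. of_bool (a' = a \<and> z = y))"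
      by (simp only: sum.distrib[symmetric] eq)
    then show ?thesis using bB \<open>finite B\<close> by (cases "a' = a") (simp_all add: of_bool_def)
  qed
  have col: "(\<Sum>a'\<in>A. d1 a' z) + of_bool (z = b) = (\<Sum>a'\<in>A. d a' z) + of_bool (z = y)" for z
  proof -
    have eq: "d1 a' z + of_bool (a' = a \<and> z = b) = d a' z + of_bool (a' = a \<and> z = y)" for a'
      using a bB by (auto simp: d1_def)
    have "(\<Sum>a'\<in>A. d1 a' z) + (\<Sum>a'\<in>A. of_bool (a' = a \<and> z = b))
      = (\<Sum>a'\<in>A. d a' z) + (\<Sum>a'\<in>A. of_bool (a' = a \<and> z = y))"
      by (simp only: sum.distrib[symmetric] eq)
    then show ?thesis using a \<open>finite A\<close> by (cases "z = b"; cases "z = y") (simp_all add: of_bool_def)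
  qed
  show ?case
  proof (intro exI[of _ d'] conjI ballI)
    fix z assume "z \<in> B"
    with d'(3) have "(\<Sum>a\<in>A. d' a z) + of_bool (z = y) = (\<Sum>a\<in>A. d1 a z) + of_bool (z = b')"
      by blast
    with col[of z]
    show "(\<Sum>a\<in>A. d' a z) + of_bool (z = b) = (\<Sum>a\<in>A. d a z) + of_bool (z = b')"
      by linarith
  qed (use d' row in auto)
qed

text \<open>Integrality of transportation problems: among the integral matrices with the right rows,
  take one whose columns exceed their targets by the least total. If it still had an overfull
  column, augmenting paths and comparison with \<open>x\<close> would give a contradiction.\<close>

lemma integral_transport:
  fixes x :: "'a \<Rightarrow> 'b \<Rightarrow> real" and c :: "'a \<Rightarrow> 'b \<Rightarrow> nat" and R :: "'a \<Rightarrow> nat" and S :: "'b \<Rightarrow> nat"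
  assumes fin: "finite A" "finite B"
    and x: "\<And>a b. a \<in> A \<Longrightarrow> b \<in> B \<Longrightarrow> 0 \<le> x a b \<and> x a b \<le> real (c a b)"
    and R: "\<And>a. a \<in> A \<Longrightarrow> (\<Sum>b\<in>B. x a b) = real (R a)"
    and S: "\<And>b. b \<in> B \<Longrightarrow> (\<Sum>a\<in>A. x a b) = real (S b)"
  shows "\<exists>d. (\<forall>a\<in>A. \<forall>b\<in>B. d a b \<le> c a b) \<and> (\<forall>a\<in>A. (\<Sum>b\<in>B. d a b) = R a) \<and>
    (\<forall>b\<in>B. (\<Sum>a\<in>A. d a b) = S b)"
proof -
  define feasible where "feasible = (\<lambda>d :: 'a \<Rightarrow> 'b \<Rightarrow> nat.
    (\<forall>a\<in>A. \<forall>b\<in>B. d a b \<le> c a b) \<and> (\<forall>a\<in>A. (\<Sum>b\<in>B. d a b) = R a))"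
  \<comment> \<open>Subtraction truncates, so only overfull columns contribute.\<close>
  define excess where "excess = (\<lambda>d :: 'a \<Rightarrow> 'b \<Rightarrow> nat. \<Sum>b\<in>B. (\<Sum>a\<in>A. d a b) - S b)"
  have "\<exists>d. (\<forall>b\<in>B. d b \<le> c a b) \<and> (\<Sum>b\<in>B. d b) = R a" if "a \<in> A" for a
  proof (rule exists_bounded_with_sum)
    have "real (R a) \<le> real (\<Sum>b\<in>B. c a b)"
      unfolding R[OF that, symmetric] of_nat_sum using x that by (intro sum_mono) auto
    then show "R a \<le> (\<Sum>b\<in>B. c a b)" by linarith
  qed (use fin in simp)
  then obtain d0 where "\<forall>a\<in>A. (\<forall>b\<in>B. d0 a b \<le> c a b) \<and> (\<Sum>b\<in>B. d0 a b) = R a" by metis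
  then have "feasible d0" by (auto simp: feasible_def)
  then obtain d where d: "feasible d" and least: "\<And>d'. feasible d' \<Longrightarrow> excess d \<le> excess d'"
    by (metis ex_has_least_nat)
  let ?s = "\<lambda>b b'. \<exists>a\<in>A. 0 < d a b \<and> d a b' < c a b'"
  have le: "(\<Sum>a\<in>A. d a b) \<le> S b" if b: "b \<in> B" for b
  proof (rule ccontr)
    assume over: "\<not> (\<Sum>a\<in>A. d a b) \<le> S b"
    \<comment> \<open>No unit can be moved from a column reachable from the overfull column \<open>b\<close> to one that is not,
      so the reachable columns carry at most what the fractional solution puts there.\<close>
    define T where "T = {b' \<in> B. \<exists>p. rtrancl_path ?s b p b' \<and> set (b # p) \<subseteq> B}"
    have T: "T \<subseteq> B" "b \<in> T"
      using that by (auto simp: T_def intro!: exI[of _ "[]"] rtrancl_path.intros)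
    \<comment> \<open>A reachable column with room would allow an augmenting path from
      \<open>b\<close>, lowering the excess.\<close>
    have full: "S z \<le> (\<Sum>a\<in>A. d a z)" if z: "z \<in> T" for z
    proof (rule ccontr)
      assume under: "\<not> S z \<le> (\<Sum>a\<in>A. d a z)"
      from z obtain p where p: "rtrancl_path ?s b p z" "set (b # p) \<subseteq> B" by (auto simp: T_def)
      obtain p' where p': "rtrancl_path ?s b p' z" "distinct (b # p')" "set p' \<subseteq> set p"
        by (rule rtrancl_path_distinct[OF p(1)])
      obtain d' where d': "\<forall>a\<in>A. \<forall>b\<in>B. d' a b \<le> c a b" "\<forall>a\<in>A. (\<Sum>b\<in>B. d' a b) = (\<Sum>b\<in>B. d a b)"
        "\<forall>y\<in>B. (\<Sum>a\<in>A. d' a y) + of_bool (y = b) = (\<Sum>a\<in>A. d a y) + of_bool (y = z)"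
      proof -
        have "set (b # p') \<subseteq> B" using p(2) p'(3) by auto
        moreover have "\<forall>a\<in>A. \<forall>b\<in>B. d a b \<le> c a b" using d by (simp add: feasible_def)
        ultimately show ?thesis using augmenting_path[OF fin p'(1,2)] that by blast
      qed
      have zb: "z \<noteq> b" using over under by auto
      have "excess d' < excess d" unfolding excess_def
      proof (rule sum_strict_mono_ex1)
        show "\<forall>y\<in>B. (\<Sum>a\<in>A. d' a y) - S y \<le> (\<Sum>a\<in>A. d a y) - S y"
        proof
          fix y assume y: "y \<in> B"
          show "(\<Sum>a\<in>A. d' a y) - S y \<le> (\<Sum>a\<in>A. d a y) - S y"
            using d'(3)[rule_format, OF y] under by (cases "y = z"; cases "y = b") auto
        qed
        show "\<exists>y\<in>B. (\<Sum>a\<in>A. d' a y) - S y < (\<Sum>a\<in>A. d a y) - S y"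
          using d'(3)[rule_format, OF b] b over zb by (intro bexI[of _ b]) auto
      qed (use fin in simp)
      moreover have "feasible d'" using d d'(1,2) by (auto simp: feasible_def)
      ultimately show False using least[of d'] by simp
    qed
    \<comment> \<open>A row with a positive entry in \<open>T\<close> is at capacity outside
      \<open>T\<close>, since otherwise \<open>T\<close> would grow. There it carries at least as
      much as \<open>x\<close>, hence at most as much inside, the row sums being equal.\<close>
    have closed: "(\<Sum>y\<in>T. d a y) \<le> (\<Sum>y\<in>T. x a y)" if a: "a \<in> A" for a
    proof (cases "\<forall>y\<in>T. d a y = 0")
      case True
      then show ?thesis using x a T(1) by (auto intro!: sum_nonneg)
    next
      case False
      then obtain y where y: "y \<in> T" "0 < d a y" by auto
      then obtain p where p: "rtrancl_path ?s b p y" "set (b # p) \<subseteq> B" by (auto simp: T_def)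
      have "c a y' \<le> d a y'" if y': "y' \<in> B - T" for y'
      proof (rule ccontr)
        assume "\<not> ?thesis"
        then have "rtrancl_path ?s y [y'] y'"
          using a y by (auto intro!: rtrancl_path.intros)
        then have "rtrancl_path ?s b (p @ [y']) y'"
          using rtrancl_path_trans[OF p(1)] by blast
        moreover have "set (b # p @ [y']) \<subseteq> B" using p(2) y' by auto
        ultimately show False using y' unfolding T_def by blast
      qed
      then have "x a y' \<le> d a y'" if "y' \<in> B - T" for y'
        using x[OF a, of y'] that by force
      then have "(\<Sum>y\<in>B - T. x a y) \<le> real (\<Sum>y\<in>B - T. d a y)"
        unfolding of_nat_sum by (rule sum_mono)
      moreover have "(\<Sum>y\<in>B. x a y) = (\<Sum>y\<in>B - T. x a y) + (\<Sum>y\<in>T. x a y)"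
        using fin T by (intro sum.subset_diff) auto
      moreover have "(\<Sum>y\<in>B. d a y) = (\<Sum>y\<in>B - T. d a y) + (\<Sum>y\<in>T. d a y)"
        using fin T by (intro sum.subset_diff) auto
      moreover have "(\<Sum>y\<in>B. x a y) = real (\<Sum>y\<in>B. d a y)"
        using R[OF a] d a by (simp add: feasible_def)
      ultimately show ?thesis by simp
    qed
    have "finite T" using T(1) fin(2) finite_subset by blast
    have "(\<Sum>y\<in>T. S y) < (\<Sum>y\<in>T. \<Sum>a\<in>A. d a y)"
      using over full T(2) \<open>finite T\<close> by (intro sum_strict_mono_ex1) (auto intro!: bexI[of _ b])
    moreover have "real (\<Sum>y\<in>T. \<Sum>a\<in>A. d a y) \<le> real (\<Sum>y\<in>T. S y)"
    proof -
      have "real (\<Sum>y\<in>T. \<Sum>a\<in>A. d a y) = (\<Sum>a\<in>A. real (\<Sum>y\<in>T. d a y))"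
        unfolding of_nat_sum by (rule sum.swap)
      also have "\<dots> \<le> (\<Sum>a\<in>A. \<Sum>y\<in>T. x a y)"
        using closed by (rule sum_mono)
      also have "\<dots> = (\<Sum>y\<in>T. \<Sum>a\<in>A. x a y)"
        by (rule sum.swap)
      also have "\<dots> = (\<Sum>y\<in>T. real (S y))"
        using S T(1) by (intro sum.cong) auto
      finally show ?thesis by simp
    qed
    ultimately show False by simp
  qed
  \<comment> \<open>Both totals equal that of \<open>x\<close>, so the column inequalities
    \<open>le\<close> are equalities.\<close>
  have "real (\<Sum>b\<in>B. \<Sum>a\<in>A. d a b) = real (\<Sum>b\<in>B. S b)"
  proof -
    have "(\<Sum>b\<in>B. \<Sum>a\<in>A. d a b) = (\<Sum>a\<in>A. R a)"
      using d by (subst sum.swap) (auto simp: feasible_def)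
    then have "real (\<Sum>b\<in>B. \<Sum>a\<in>A. d a b) = (\<Sum>a\<in>A. \<Sum>b\<in>B. x a b)"
      using R by simp
    also have "\<dots> = (\<Sum>b\<in>B. \<Sum>a\<in>A. x a b)"
      by (rule sum.swap)
    finally show ?thesis using S by simp
  qed
  then have tot: "(\<Sum>b\<in>B. \<Sum>a\<in>A. d a b) = (\<Sum>b\<in>B. S b)" by linarith
  have "(\<Sum>a\<in>A. d a b) = S b" if "b \<in> B" for b
    using sum_mono_inv[OF tot le that fin(2)] .
  with d show ?thesis by (auto simp: feasible_def)
qed

subsection \<open>Binomial estimates\<close>

text \<open>Each tail \<open>Q (Suc i)\<close> is at most half of \<open>Q i\<close>, so
  \<open>2 ^ i * Q i\<close> is at most the full Vandermonde sum, and \<open>Suc i\<close> \<le>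
  \<open>2 ^ i\<close>. It is applied with \<open>H = h - 1\<close>, \<open>M = m - 1\<close>,
  \<open>L = n - m\<close>.\<close>

lemma hypergeometric_tail_bound:
  assumes M: "H * M + H \<le> L" and half: "(L + M) choose H \<le> 2 * (L choose H)"
  shows "Suc i * (\<Sum>t=i..H. (M choose t) * (L choose (H - t))) \<le> (L + M) choose H"
proof -
  define a where "a = (\<lambda>t. (M choose t) * (L choose (H - t)))"
  define Q where "Q = (\<lambda>i. \<Sum>t=i..H. a t)"
  have Q0: "Q 0 = (L + M) choose H"
    using vandermonde[of M L H] by (simp add: Q_def a_def atMost_atLeast0 add.commute)
  \<comment> \<open>The ratio argument below gives no factor 2 between the terms 0 and 1; this first
    halving is exactly \<open>half\<close>.\<close>
  have Q1: "2 * Q 1 \<le> Q 0"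
  proof -
    have "Q 0 = a 0 + Q 1" by (simp add: Q_def sum.atLeast_Suc_atMost)
    with half show ?thesis unfolding Q0[symmetric] by (simp add: a_def)
  qed
  \<comment> \<open>The ratio of consecutive terms is
    \<open>(M - t) * (H - t) / (Suc t * D)\<close>. By the assumption \<open>M\<close> the product
    in the numerator is at most \<open>D\<close>, and \<open>Suc t\<close> is at least 2.\<close>
  have halving: "2 * a (Suc t) \<le> a t" if t: "1 \<le> t" "t < H" for t
  proof -
    define D where "D = L - (H - Suc t)"
    have eq1: "Suc t * (M choose Suc t) = (M - t) * (M choose t)"
      by (metis binomial_absorb_comp binomial_absorption mult.commute)
    have eq2: "(H - t) * (L choose (H - t)) = D * (L choose (H - Suc t))"
    proof -
      have "H - t = Suc (H - Suc t)" using t by simp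
      then show ?thesis unfolding D_def
        by (metis binomial_absorb_comp binomial_absorption mult.commute)
    qed
    have "H - t + H * M \<le> L" using M t by linarith
    then have D: "H * M \<le> D" "0 < D" using M t by (auto simp: D_def)
    have "(M - t) * (H - t) \<le> M * H" by (intro mult_le_mono) auto
    then have le: "(M - t) * (H - t) \<le> D" using D(1) by (simp add: mult.commute)
    have "D * (Suc t * a (Suc t)) = (Suc t * (M choose Suc t)) * (D * (L choose (H - Suc t)))"
      by (simp add: a_def algebra_simps)
    also have "\<dots> = (M - t) * (H - t) * a t"
      unfolding eq1 eq2[symmetric] by (simp add: a_def)
    also have "\<dots> \<le> D * a t" using le by (rule mult_le_mono1)
    finally have "Suc t * a (Suc t) \<le> a t" using D(2) by simp
    moreover have "2 * a (Suc t) \<le> Suc t * a (Suc t)" using t by (intro mult_le_mono1) auto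
    ultimately show ?thesis by (rule order_trans[rotated])
  qed
  have step: "2 * Q (Suc i) \<le> Q i" if "1 \<le> i" for i
  proof (cases "i < H")
    case True
    have "2 * Q (Suc i) = (\<Sum>t=i..H-1. 2 * a (Suc t))"
      unfolding Q_def sum_distrib_left[symmetric]
      using True sum.shift_bounds_cl_Suc_ivl[of a i "H - 1"] by simp
    also have "\<dots> \<le> (\<Sum>t=i..H-1. a t)"
      using halving that True by (intro sum_mono) auto
    also have "\<dots> \<le> Q i" unfolding Q_def by (intro sum_mono2) auto
    finally show ?thesis .
  qed (simp add: Q_def)
  have pow: "2 ^ i * Q i \<le> Q 0" for i
  proof (induction i)
    case (Suc i)
    then have "2 * Q (Suc i) \<le> Q i" using step[of i] Q1 by (cases i) auto
    then have "2 ^ Suc i * Q (Suc i) \<le> 2 ^ i * Q i" by simp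
    then show ?case using Suc by (rule order_trans)
  qed simp
  have "Suc i \<le> 2 ^ i" using less_exp[of i] by (simp add: Suc_le_eq)
  then have "Suc i * Q i \<le> 2 ^ i * Q i" by (rule mult_le_mono1)
  with pow[of i] Q0 show ?thesis by (simp add: Q_def a_def)
qed

text \<open>The quotient of the two binomials is the product of the factors
  \<open>(L - i) / (N - i)\<close>, which decrease in \<open>i\<close>. The last assumption bounds
  the factor at \<open>i = H - 1\<close>, hence all of them, by \<open>q\<close> from below.\<close>

lemma binomial_ratio_lower_bound:
  fixes q :: real
  assumes q: "0 \<le> q" "q \<le> 1" and "H \<le> Suc L" "L \<le> N" and "q * (real N - real H + 1) \<le> real L - real H + 1"
  shows "a \<le> H \<Longrightarrow> q ^ a * (N choose a) \<le> L choose a"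
proof (induction a)
  case (Suc a)
  \<comment> \<open>Added to the last assumption, this carries the bound from the factor at
    \<open>H - 1\<close> to the factor at \<open>a\<close>.\<close>
  have "q * (real H - 1 - real a) \<le> 1 * (real H - 1 - real a)"
    using q Suc.prems by (intro mult_right_mono) auto
  then have step: "q * real (N - a) \<le> real (L - a)"
    using Suc.prems assms by (simp add: of_nat_diff algebra_simps)
  have ab: "real (Suc a) * real (n choose Suc a) = real (n - a) * real (n choose a)" for n
    by (metis binomial_absorb_comp binomial_absorption mult.commute of_nat_mult)
  have "real (Suc a) * (q ^ Suc a * (N choose Suc a)) = q ^ Suc a * (real (Suc a) * real (N choose Suc a))"
    by simp
  also have "\<dots> = (q * real (N - a)) * (q ^ a * (N choose a))"
    unfolding ab by simp
  also have "\<dots> \<le> real (L - a) * (L choose a)"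
    using Suc step q by (intro mult_mono) auto
  also have "\<dots> = real (Suc a) * (L choose Suc a)" unfolding ab ..
  finally show ?case by (simp del: of_nat_Suc)
qed simp

text \<open>The rest of the proof uses the bound on \<open>n\<close> only through these two facts.
  With \<open>q ^ (h - 1) = 1 / 2\<close>, the bound says that each factor of the binomial quotient
  is at least \<open>q\<close>; and \<open>1 / (1 - q)\<close> \<ge> \<open>h\<close> by Bernoulli's
  inequality.\<close>

lemma size_bound_consequences:
  fixes h m n :: nat
  assumes h: "h \<ge> 2" and m: "m \<ge> 1"
    and n: "real n > (real m - 1) / (1 - 2 powr (1 / (1 - real h))) + real h - 1"
  shows "h * m \<le> n" and "(n - 1) choose (h - 1) \<le> 2 * ((n - m) choose (h - 1))"
proof -
  define H where "H = h - 1"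
  have hH: "h = Suc H" and H: "1 \<le> H" using h by (auto simp: H_def)
  define q where "q = (2::real) powr (1 / (1 - real h))"
  have q_pos: "0 < q" by (simp add: q_def)
  have "q < 2 powr 0" unfolding q_def using h by (intro powr_less_mono) (auto simp: field_simps)
  then have q1: "q < 1" by simp
  have qH: "q ^ H = 1 / 2"
  proof -
    have "q ^ H = q powr real H" using q_pos by (simp add: powr_realpow)
    also have "\<dots> = 2 powr (1 / (1 - real h) * real H)" by (simp add: q_def powr_powr)
    also have "1 / (1 - real h) * real H = - 1" using H by (simp add: hH field_simps)
    finally show ?thesis by (simp add: powr_minus_divide)
  qed
  have bern: "(real H / real h) ^ H \<le> 1 / 2"
  proof -
    have "1 + real H * (1 / real H) \<le> (1 + 1 / real H) ^ H"
      by (rule Bernoulli_inequality) (simp add: order_trans[of _ 0])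
    then have "2 \<le> (1 + 1 / real H) ^ H" using H by simp
    also have "1 + 1 / real H = real h / real H" using H by (simp add: hH field_simps)
    finally show ?thesis using H h by (simp add: power_divide field_simps)
  qed
  \<comment> \<open>Comparison of \<open>H\<close>-th powers.\<close>
  have "real H / real h \<le> q"
    using bern qH q_pos H by (metis less_eq_real_def of_nat_0_le_iff divide_nonneg_nonneg
        power_mono_iff Suc_le_lessD One_nat_def)
  then have qh: "real h * (1 - q) \<le> 1" using h by (simp add: hH field_simps)
  then have "real h \<le> 1 / (1 - q)" using q1 by (simp add: field_simps)
  then have "real h * (real m - 1) \<le> (real m - 1) / (1 - q)"
    using m mult_right_mono[of "real h" "1 / (1 - q)" "real m - 1"] by simp
  with n have "real h * (real m - 1) + real h - 1 < real n" by (simp add: q_def)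
  then have "real (h * m) < real (n + 1)" by (simp add: algebra_simps)
  then show hm: "h * m \<le> n" by linarith
  have "m + h \<le> h * m + 1"
    using h m by (cases m; cases h) auto
  then have mn: "m + H \<le> n" "m \<le> n" using hm hH by linarith+
  have "(real m - 1) / (1 - q) < real n - real H"
    using n by (simp add: q_def hH)
  then have "real m - 1 < (real n - real H) * (1 - q)" using q1 by (simp add: field_simps)
  then have "q * (real (n - 1) - real H + 1) \<le> real (n - m) - real H + 1"
    using mn m by (simp add: of_nat_diff algebra_simps)
  then have "q ^ H * ((n - 1) choose H) \<le> (n - m) choose H"
    using q_pos q1 mn m by (intro binomial_ratio_lower_bound[where H = H]) auto
  then have "real ((n - 1) choose H) \<le> real (2 * ((n - m) choose H))" by (simp add: qH)
  then show "(n - 1) choose (h - 1) \<le> 2 * ((n - m) choose (h - 1))"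
    unfolding H_def of_nat_le_iff .
qed

subsection \<open>Colorings of traces\<close>

text \<open>Pigeonhole: if each color were saturated at some vertex of an unfinished
  \<open>X\<close>, the colored degrees on \<open>X\<close> would add up to at least the sum of
  \<open>r\<close>. They are strictly below the final degrees given by \<open>q\<close>, which
  \<open>room\<close> bounds by that sum. So some color is free on all of \<open>X\<close>, and
  edges can be colored one at a time.\<close>

lemma greedy_fill:
  fixes c :: "'a set \<Rightarrow> 'b \<Rightarrow> nat"
  assumes W: "finite W" and J: "finite J"
    and sums: "\<forall>X\<subseteq>W. (\<Sum>j\<in>J. c X j) \<le> q X"
    and degs: "\<forall>x\<in>W. \<forall>j\<in>J. (\<Sum>X | X \<subseteq> W \<and> x \<in> X. c X j) \<le> r j"
    and room: "\<forall>X\<subseteq>W. (\<Sum>j\<in>J. c X j) < q X \<longrightarrow>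
      X \<noteq> {} \<and> (\<Sum>x\<in>X. \<Sum>Y | Y \<subseteq> W \<and> x \<in> Y. q Y) \<le> (\<Sum>j\<in>J. r j)"
  shows "\<exists>c'. (\<forall>X j. c X j \<le> c' X j) \<and> (\<forall>X\<subseteq>W. (\<Sum>j\<in>J. c' X j) = q X) \<and>
    (\<forall>x\<in>W. \<forall>j\<in>J. (\<Sum>X | X \<subseteq> W \<and> x \<in> X. c' X j) \<le> r j)"
  using sums degs room
proof (induction "\<Sum>X\<in>Pow W. q X - (\<Sum>j\<in>J. c X j)" arbitrary: c rule: less_induct)
  case less
  show ?case
  proof (cases "\<forall>X\<subseteq>W. (\<Sum>j\<in>J. c X j) = q X")
    case True
    with less.prems show ?thesis by (intro exI[of _ c]) auto
  next
    case False
    with less.prems(1) obtain X0 where X0: "X0 \<subseteq> W" "(\<Sum>j\<in>J. c X0 j) < q X0"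
      by (meson le_neq_implies_less)
    then have ne: "X0 \<noteq> {}" and rm: "(\<Sum>x\<in>X0. \<Sum>Y | Y \<subseteq> W \<and> x \<in> Y. q Y) \<le> (\<Sum>j\<in>J. r j)"
      using less.prems(3) by auto
    have finX0: "finite X0" using X0(1) W finite_subset by blast
    have "\<exists>j\<in>J. \<forall>x\<in>X0. (\<Sum>Y | Y \<subseteq> W \<and> x \<in> Y. c Y j) < r j"
    proof (rule ccontr)
      assume "\<not> ?thesis"
      then have sat: "\<exists>x\<in>X0. r j \<le> (\<Sum>Y | Y \<subseteq> W \<and> x \<in> Y. c Y j)" if "j \<in> J" for j
        using that by (meson not_less)
      have "(\<Sum>j\<in>J. r j) \<le> (\<Sum>j\<in>J. \<Sum>x\<in>X0. \<Sum>Y | Y \<subseteq> W \<and> x \<in> Y. c Y j)"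
      proof (rule sum_mono)
        fix j assume "j \<in> J"
        then obtain x where x: "x \<in> X0" "r j \<le> (\<Sum>Y | Y \<subseteq> W \<and> x \<in> Y. c Y j)" using sat by blast
        note x(2)
        also have "(\<Sum>Y | Y \<subseteq> W \<and> x \<in> Y. c Y j) \<le> (\<Sum>x\<in>X0. \<Sum>Y | Y \<subseteq> W \<and> x \<in> Y. c Y j)"
          using x(1) finX0 by (intro member_le_sum) auto
        finally show "r j \<le> (\<Sum>x\<in>X0. \<Sum>Y | Y \<subseteq> W \<and> x \<in> Y. c Y j)" .
      qed
      also have "\<dots> = (\<Sum>x\<in>X0. \<Sum>j\<in>J. \<Sum>Y | Y \<subseteq> W \<and> x \<in> Y. c Y j)"
        by (rule sum.swap)
      also have "\<dots> = (\<Sum>x\<in>X0. \<Sum>Y | Y \<subseteq> W \<and> x \<in> Y. \<Sum>j\<in>J. c Y j)"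
        by (intro sum.cong refl sum.swap)
      \<comment> \<open>Strict because \<open>X0\<close> is nonempty and its uncolored copy is
        missing at each of its vertices.\<close>
      also have "\<dots> < (\<Sum>x\<in>X0. \<Sum>Y | Y \<subseteq> W \<and> x \<in> Y. q Y)"
      proof (rule sum_strict_mono)
        fix x assume x: "x \<in> X0"
        show "(\<Sum>Y | Y \<subseteq> W \<and> x \<in> Y. \<Sum>j\<in>J. c Y j) < (\<Sum>Y | Y \<subseteq> W \<and> x \<in> Y. q Y)"
        proof (rule sum_strict_mono_ex1)
          show "finite {Y. Y \<subseteq> W \<and> x \<in> Y}" using W by simp
          show "\<forall>Y\<in>{Y. Y \<subseteq> W \<and> x \<in> Y}. (\<Sum>j\<in>J. c Y j) \<le> q Y" using less.prems(1) by simp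
          show "\<exists>Y\<in>{Y. Y \<subseteq> W \<and> x \<in> Y}. (\<Sum>j\<in>J. c Y j) < q Y" using X0 x by blast
        qed
      qed (use ne finX0 in auto)
      finally show False using rm by simp
    qed
    then obtain j0 where j0: "j0 \<in> J" and free: "\<forall>x\<in>X0. (\<Sum>Y | Y \<subseteq> W \<and> x \<in> Y. c Y j0) < r j0" by blast
    define c1 where "c1 = (\<lambda>X j. c X j + of_bool (X = X0 \<and> j = j0))"
    have sum1: "(\<Sum>j\<in>J. c1 X j) = (\<Sum>j\<in>J. c X j) + of_bool (X = X0)" for X
      using J j0 by (cases "X = X0") (simp_all add: c1_def sum.distrib of_bool_def)
    have deg1: "(\<Sum>X | X \<subseteq> W \<and> x \<in> X. c1 X j) =
      (\<Sum>X | X \<subseteq> W \<and> x \<in> X. c X j) + of_bool (x \<in> X0 \<and> j = j0)" for x j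
      using W X0(1) by (cases "j = j0") (simp_all add: c1_def sum.distrib of_bool_def)
    have "(\<Sum>X\<in>Pow W. q X - (\<Sum>j\<in>J. c1 X j)) < (\<Sum>X\<in>Pow W. q X - (\<Sum>j\<in>J. c X j))"
      using W X0 by (intro sum_strict_mono_ex1) (auto simp: sum1 intro!: bexI[of _ X0])
    moreover have "\<forall>X\<subseteq>W. (\<Sum>j\<in>J. c1 X j) \<le> q X"
      using less.prems(1) X0 by (auto simp: sum1)
    moreover have "\<forall>x\<in>W. \<forall>j\<in>J. (\<Sum>X | X \<subseteq> W \<and> x \<in> X. c1 X j) \<le> r j"
      using less.prems(2) free by (auto simp: deg1 Suc_le_eq)
    moreover have "\<forall>X\<subseteq>W. (\<Sum>j\<in>J. c1 X j) < q X \<longrightarrow>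
      X \<noteq> {} \<and> (\<Sum>x\<in>X. \<Sum>Y | Y \<subseteq> W \<and> x \<in> Y. q Y) \<le> (\<Sum>j\<in>J. r j)"
    proof (intro allI impI)
      fix X assume "X \<subseteq> W" "(\<Sum>j\<in>J. c1 X j) < q X"
      then have "(\<Sum>j\<in>J. c X j) < q X" using add_lessD1 unfolding sum1 by blast
      with \<open>X \<subseteq> W\<close> less.prems(3)
      show "X \<noteq> {} \<and> (\<Sum>x\<in>X. \<Sum>Y | Y \<subseteq> W \<and> x \<in> Y. q Y) \<le> (\<Sum>j\<in>J. r j)"
        by simp
    qed
    ultimately obtain c' where c': "\<forall>X j. c1 X j \<le> c' X j" "\<forall>X\<subseteq>W. (\<Sum>j\<in>J. c' X j) = q X"
      "\<forall>x\<in>W. \<forall>j\<in>J. (\<Sum>X | X \<subseteq> W \<and> x \<in> X. c' X j) \<le> r j"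
      using less.hyps[of c1] by blast
    have "c X j \<le> c' X j" for X j
    proof -
      have "c X j \<le> c1 X j" by (simp add: c1_def)
      then show ?thesis using c'(1) by (blast intro: order_trans)
    qed
    with c'(2,3) show ?thesis by blast
  qed
qed

text \<open>The number of edges whose trace on the vertices already split off is a given set of \<open>t\<close> vertices,
  when \<open>s\<close> vertices are still identified.\<close>

definition trace_mult :: "nat \<Rightarrow> nat \<Rightarrow> nat \<Rightarrow> nat \<Rightarrow> nat" where
  "trace_mult l h s t = (if t \<le> h then l * (s choose (h - t)) else 0)"

text \<open>\<open>c X j\<close> is the number of edges of color \<open>j\<close> with trace \<open>X\<close> on \<open>U\<close>. The last condition fixes the
  number of edges of color \<open>j\<close>; it makes the identified vertices have the right total degree.\<close>

definition trace_factorization ::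
  "nat \<Rightarrow> nat \<Rightarrow> nat \<Rightarrow> 'b set \<Rightarrow> ('b \<Rightarrow> nat) \<Rightarrow> 'a set \<Rightarrow> ('a set \<Rightarrow> 'b \<Rightarrow> nat) \<Rightarrow> bool" where
  "trace_factorization n h l J r U c \<longleftrightarrow>
     (\<forall>X\<subseteq>U. (\<Sum>j\<in>J. c X j) = trace_mult l h (n - card U) (card X)) \<and>
     (\<forall>x\<in>U. \<forall>j\<in>J. (\<Sum>X | X \<subseteq> U \<and> x \<in> X. c X j) = r j) \<and>
     (\<forall>j\<in>J. h * (\<Sum>X\<in>Pow U. c X j) = r j * n)"

section \<open>Splitting off identified vertices\<close>

lemma trace_factorization_add_vertex:
  fixes c :: "'a set \<Rightarrow> 'b \<Rightarrow> nat"
  assumes U: "finite U" "card U < n" "v \<notin> U" and J: "finite J"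
    and c: "trace_factorization n h l J r U c"
  shows "\<exists>c'. trace_factorization n h l J r (insert v U) c' \<and>
    (\<forall>X\<subseteq>U. card X = h \<longrightarrow> (\<forall>j\<in>J. c' X j = c X j))"
proof -
  define s where "s = n - card U"
  have s: "0 < s" "n = card U + s" "n - card (insert v U) = s - 1" using U by (auto simp: s_def)
  have c1: "(\<Sum>j\<in>J. c X j) = trace_mult l h s (card X)" if "X \<subseteq> U" for X
    using c that by (simp add: trace_factorization_def s_def)
  have c2: "(\<Sum>X | X \<subseteq> U \<and> x \<in> X. c X j) = r j" if "x \<in> U" "j \<in> J" for x j
    using c that by (simp add: trace_factorization_def)
  have c3: "h * (\<Sum>X\<in>Pow U. c X j) = r j * n" if "j \<in> J" for j
    using c that by (simp add: trace_factorization_def)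
  \<comment> \<open>An edge with trace \<open>X\<close> has \<open>h - card X\<close> of its
    vertices among the \<open>s\<close> identified ones, so this is the average number of such edges
    that one of them receives.\<close>
  define x where "x = (\<lambda>X j. real (c X j) * real (h - card X) / real s)"
  define R where "R = (\<lambda>X :: 'a set. if card X < h then trace_mult l h (s - 1) (Suc (card X)) else 0)"
  have R: "(\<Sum>j\<in>J. x X j) = real (R X)" if "X \<in> Pow U" for X
  proof -
    have "(\<Sum>j\<in>J. x X j) = real (\<Sum>j\<in>J. c X j) * real (h - card X) / real s"
      by (simp add: x_def sum_distrib_right sum_divide_distrib)
    also have "\<dots> = real (R X)"
    proof (cases "card X < h")
      case True
      define a where "a = h - Suc (card X)"
      have a: "h - card X = Suc a" using True by (simp add: a_def)
      have "Suc a * (s choose Suc a) = s * ((s - 1) choose a)"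
        by (rule binomial_absorption)
      then have "real (s choose Suc a) * real (Suc a) = real s * real ((s - 1) choose a)"
        by (metis mult.commute of_nat_mult)
      with True s(1) show ?thesis using c1[of X] that
        by (simp add: R_def trace_mult_def a a_def[symmetric] field_simps del: of_nat_Suc binomial_Suc_Suc)
    qed (use c1[of X] that in \<open>auto simp: R_def trace_mult_def\<close>)
    finally show ?thesis .
  qed
  \<comment> \<open>Traces with more than \<open>h\<close> vertices, or with too few to be completed
    by \<open>s\<close> others, carry no edge. So the fraction is at most 1 and
    \<open>h - card X\<close> does not truncate wherever \<open>c X j\<close> is positive.\<close>
  have vanish: "c X j = 0" if "X \<subseteq> U" "j \<in> J" "\<not> (card X \<le> h \<and> h - card X \<le> s)" for X j
  proof -
    have "(\<Sum>j\<in>J. c X j) = 0" using that c1[of X] by (auto simp: trace_mult_def)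
    then show ?thesis using J that by simp
  qed
  have bound: "0 \<le> x X j \<and> x X j \<le> real (c X j)" if "X \<in> Pow U" "j \<in> J" for X j
  proof (cases "card X \<le> h \<and> h - card X \<le> s")
    case True
    then have "real (c X j) * real (h - card X) \<le> real (c X j) * real s"
      by (intro mult_left_mono) auto
    then show ?thesis using s(1) by (simp add: x_def field_simps)
  next
    case False
    then show ?thesis using vanish[of X j] that by (simp add: x_def)
  qed
  \<comment> \<open>Color \<open>j\<close> has total degree \<open>r j * n\<close>, of which
    \<open>card U * r j\<close> lies on \<open>U\<close>; the remaining \<open>s * r j\<close> is
    shared equally by the \<open>s\<close> identified vertices.\<close>
  have S: "(\<Sum>X\<in>Pow U. x X j) = real (r j)" if j: "j \<in> J" for j
  proof -
    have eq: "(h - card X) * c X j + card X * c X j = h * c X j" if "X \<in> Pow U" for X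
      using vanish[of X j] that j by (cases "card X \<le> h") (auto simp: add_mult_distrib[symmetric])
    have "(\<Sum>X\<in>Pow U. card X * c X j) = card U * r j"
      using c2 j by (simp add: sum_degrees[OF U(1), symmetric])
    moreover have "(\<Sum>X\<in>Pow U. (h - card X) * c X j) + (\<Sum>X\<in>Pow U. card X * c X j) = r j * n"
      using c3[OF j] eq by (simp add: sum.distrib[symmetric] sum_distrib_left)
    ultimately have "(\<Sum>X\<in>Pow U. (h - card X) * c X j) = s * r j"
      using s(2) by (simp add: algebra_simps)
    then have "real (\<Sum>X\<in>Pow U. (h - card X) * c X j) = real s * real (r j)" by simp
    then show ?thesis using s(1)
      by (simp add: x_def sum_divide_distrib[symmetric] mult.commute)
  qed
  obtain d where d: "\<forall>X\<in>Pow U. \<forall>j\<in>J. d X j \<le> c X j" "\<forall>X\<in>Pow U. (\<Sum>j\<in>J. d X j) = R X"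
    "\<forall>j\<in>J. (\<Sum>X\<in>Pow U. d X j) = r j"
    using integral_transport[of "Pow U" J x c R r] U(1) J bound R S by auto
  \<comment> \<open>Of the edges with trace \<open>X\<close> and color \<open>j\<close>,
    \<open>d X j\<close> acquire the vertex \<open>v\<close> and the others keep their
    trace.\<close>
  define c' where "c' = (\<lambda>X j. if v \<in> X then d (X - {v}) j else c X j - d X j)"
  have c'_old: "c' X j = c X j - d X j" and c'_new: "c' (insert v X) j = d X j" if "X \<subseteq> U" for X j
  proof -
    have "v \<notin> X" using that U(3) by auto
    then show "c' X j = c X j - d X j" "c' (insert v X) j = d X j" by (auto simp: c'_def)
  qed
  have split: "c' X j + c' (insert v X) j = c X j" if "X \<subseteq> U" "j \<in> J" for X j
    using d(1) that by (simp add: c'_old c'_new)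
  have old: "(\<Sum>j\<in>J. c' X j) = trace_mult l h (s - 1) (card X)" if X: "X \<subseteq> U" for X
  proof -
    have "(\<Sum>j\<in>J. c' X j) + (\<Sum>j\<in>J. c' (insert v X) j) = (\<Sum>j\<in>J. c X j)"
      using split[OF X] by (simp add: sum.distrib[symmetric])
    moreover have "(\<Sum>j\<in>J. c' (insert v X) j) = R X"
      using d(2) X by (simp add: c'_new)
    ultimately have *: "(\<Sum>j\<in>J. c' X j) + R X = trace_mult l h s (card X)"
      using c1[OF X] by simp
    obtain s' where s': "s = Suc s'" using s(1) by (cases s) auto
    show ?thesis
    \<comment> \<open>Pascal's rule for the traces that do not acquire \<open>v\<close>.\<close>
    proof (cases "card X < h")
      case True
      define a where "a = h - Suc (card X)"
      have "h - card X = Suc a" using True by (simp add: a_def)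
      with True * show ?thesis
        by (simp add: R_def trace_mult_def a_def[symmetric] s' algebra_simps)
    qed (use * in \<open>auto simp: R_def trace_mult_def\<close>)
  qed
  have new: "(\<Sum>j\<in>J. c' (insert v X) j) = trace_mult l h (s - 1) (card (insert v X))" if X: "X \<subseteq> U" for X
  proof -
    have "card (insert v X) = Suc (card X)"
      using X U finite_subset[OF X U(1)] by (intro card_insert_disjoint) auto
    then show ?thesis using d(2) X by (auto simp: c'_new R_def trace_mult_def)
  qed
  have "trace_factorization n h l J r (insert v U) c'"
    unfolding trace_factorization_def s(3)
  proof (intro conjI ballI allI impI)
    fix X assume "X \<subseteq> insert v U"
    then consider "X \<subseteq> U" | Y where "X = insert v Y" "Y \<subseteq> U"
      by (metis subset_insert_iff insert_Diff)
    then show "(\<Sum>j\<in>J. c' X j) = trace_mult l h (s - 1) (card X)"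
      using old new by cases auto
  next
    fix y j assume y: "y \<in> insert v U" and j: "j \<in> J"
    show "(\<Sum>X | X \<subseteq> insert v U \<and> y \<in> X. c' X j) = r j"
    proof (cases "y = v")
      case True
      have "insert v U - {v} = U" using U(3) by auto
      with True show ?thesis using d(3) j
        by (simp add: sum_subsets_containing c'_new)
    next
      case False
      then have yU: "y \<in> U" using y by simp
      have "insert v U - {y} = insert v (U - {y})" using False by auto
      then have "(\<Sum>X | X \<subseteq> insert v U \<and> y \<in> X. c' X j)
        = (\<Sum>X\<in>Pow (U - {y}). c' (insert y X) j) + (\<Sum>X\<in>Pow (U - {y}). c' (insert y (insert v X)) j)"
        using y U by (simp add: sum_subsets_containing sum_Pow_insert)
      also have "\<dots> = (\<Sum>X\<in>Pow (U - {y}). c (insert y X) j)"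
        unfolding sum.distrib[symmetric]
      proof (rule sum.cong)
        fix X assume "X \<in> Pow (U - {y})"
        then have "insert y X \<subseteq> U" using yU by auto
        from split[OF this j] show "c' (insert y X) j + c' (insert y (insert v X)) j = c (insert y X) j"
          by (simp add: insert_commute)
      qed simp
      also have "\<dots> = r j"
        using c2[OF yU j] yU by (simp add: sum_subsets_containing)
      finally show ?thesis .
    qed
  next
    fix j assume j: "j \<in> J"
    have "(\<Sum>X\<in>Pow (insert v U). c' X j) = (\<Sum>X\<in>Pow U. c X j)"
      using U(1,3) split j by (simp add: sum_Pow_insert sum.distrib[symmetric])
    then show "h * (\<Sum>X\<in>Pow (insert v U). c' X j) = r j * n" using c3[OF j] by simp
  qed
  moreover have "c' X j = c X j" if "X \<subseteq> U" "card X = h" "j \<in> J" for X j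
  proof -
    \<comment> \<open>Edges lying wholly in \<open>U\<close> have no vertex left to give to
      \<open>v\<close>, so their colors are frozen.\<close>
    have "(\<Sum>j\<in>J. d X j) = 0" using d(2) that by (simp add: R_def)
    then show ?thesis using that J by (simp add: c'_old)
  qed
  ultimately show ?thesis by blast
qed

lemma trace_factorization_extend:
  fixes c :: "'a set \<Rightarrow> 'b \<Rightarrow> nat"
  assumes "finite D" "finite W" "W \<inter> D = {}" "n = card W + card D" "finite J"
    and "trace_factorization n h l J r W c"
  shows "\<exists>c'. trace_factorization n h l J r (W \<union> D) c' \<and>
    (\<forall>X\<subseteq>W. card X = h \<longrightarrow> (\<forall>j\<in>J. c' X j = c X j))"
  using assms
proof (induction D arbitrary: W c rule: finite_induct)
  case (insert v D)
  obtain c1 where c1: "trace_factorization n h l J r (insert v W) c1"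
    "\<forall>X\<subseteq>W. card X = h \<longrightarrow> (\<forall>j\<in>J. c1 X j = c X j)"
    using trace_factorization_add_vertex[of W n v J h l r c] insert by auto
  obtain c' where c': "trace_factorization n h l J r (insert v W \<union> D) c'"
    "\<forall>X\<subseteq>insert v W. card X = h \<longrightarrow> (\<forall>j\<in>J. c' X j = c1 X j)"
    using insert.IH[of "insert v W" c1] insert.prems insert.hyps c1(1) by auto
  show ?case
  proof (intro exI conjI allI impI ballI)
    show "trace_factorization n h l J r (W \<union> insert v D) c'" using c'(1) by simp
    fix X j assume "X \<subseteq> W" "card X = h" "j \<in> J"
    then show "c' X j = c X j" using c'(2) c1(2) by (simp add: subset_insertI2)
  qed
qed auto

section \<open>Coloring all traces on the given vertex set\<close>

lemma sum_trace_mult: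
  assumes "finite W" "card W \<le> n"
  shows "(\<Sum>X\<in>Pow W. trace_mult l h (n - card W) (card X)) = l * (n choose h)"
proof -
  have "(\<Sum>X\<in>Pow W. trace_mult l h (n - card W) (card X))
    = (\<Sum>t\<le>card W. (card W choose t) * trace_mult l h (n - card W) t)"
    using assms(1) by (rule sum_Pow_card)
  also have "\<dots> = (\<Sum>t\<le>h. l * ((card W choose t) * ((n - card W) choose (h - t))))"
    by (rule sum.mono_neutral_cong) (auto simp: trace_mult_def)
  also have "\<dots> = l * (n choose h)"
    unfolding sum_distrib_left[symmetric] vandermonde using assms(2) by simp
  finally show ?thesis .
qed

text \<open>Removing \<open>x\<close> from its traces lowers sizes by one, hence the shifted
  indices. For \<open>i = 1\<close> the right side is a Vandermonde sum, the degree of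
  \<open>x\<close>; for larger \<open>i\<close> it is the tail estimated by
  \<open>hypergeometric_tail_bound\<close>.\<close>

lemma sum_trace_mult_containing:
  assumes "finite W" "x \<in> W" "1 \<le> i" "1 \<le> h"
  shows "(\<Sum>X | X \<subseteq> W \<and> x \<in> X. if i \<le> card X then trace_mult l h s (card X) else 0)
    = l * (\<Sum>t=i-1..h-1. ((card W - 1) choose t) * (s choose (h - 1 - t)))"
proof -
  define \<phi> where "\<phi> = (\<lambda>t. if i \<le> Suc t then trace_mult l h s (Suc t) else 0)"
  have "(\<Sum>X | X \<subseteq> W \<and> x \<in> X. if i \<le> card X then trace_mult l h s (card X) else 0)
    = (\<Sum>X\<in>Pow (W - {x}). \<phi> (card X))"
    unfolding sum_subsets_containing[OF assms(2)]
  proof (rule sum.cong)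
    fix X assume "X \<in> Pow (W - {x})"
    then have "card (insert x X) = Suc (card X)"
      using assms(1) finite_subset by (intro card_insert_disjoint) auto
    then show "(if i \<le> card (insert x X) then trace_mult l h s (card (insert x X)) else 0) = \<phi> (card X)"
      by (simp add: \<phi>_def)
  qed simp
  also have "\<dots> = (\<Sum>t\<le>card W - 1. ((card W - 1) choose t) * \<phi> t)"
    using sum_Pow_card[of "W - {x}" \<phi>] assms by simp
  also have "\<dots> = (\<Sum>t=i-1..h-1. l * (((card W - 1) choose t) * (s choose (h - 1 - t))))"
    using assms(3,4) by (intro sum.mono_neutral_cong) (auto simp: \<phi>_def trace_mult_def)
  finally show "(\<Sum>X | X \<subseteq> W \<and> x \<in> X. if i \<le> card X then trace_mult l h s (card X) else 0)
    = l * (\<Sum>t=i-1..h-1. ((card W - 1) choose t) * (s choose (h - 1 - t)))"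
    by (simp add: sum_distrib_left)
qed

text \<open>\<open>c0\<close> holds the color counts of the edges inside \<open>W\<close>. Greedy
  filling down to size 1 makes the degrees on \<open>W\<close> exact, and the edges avoiding
  \<open>W\<close> then bring each color to its required size \<open>r j * n div h\<close>.\<close>

lemma trace_factorization_exists:
  fixes c0 :: "'a set \<Rightarrow> 'b \<Rightarrow> nat"
  assumes h: "h \<ge> 1" and W: "finite W" "W \<noteq> {}" and J: "finite J"
    and hm: "h * card W \<le> n"
    and half: "(n - 1) choose (h - 1) \<le> 2 * ((n - card W) choose (h - 1))"
    and r: "(\<Sum>j\<in>J. r j) = l * ((n - 1) choose (h - 1))" "\<forall>j\<in>J. h dvd r j * n"
    and c0: "\<forall>X\<subseteq>W. (\<Sum>j\<in>J. c0 X j) = (if card X = h then l else 0)"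
    and deg0: "\<forall>x\<in>W. \<forall>j\<in>J. (\<Sum>X | X \<subseteq> W \<and> x \<in> X. c0 X j) \<le> r j"
  shows "\<exists>c. trace_factorization n h l J r W c \<and>
    (\<forall>X\<subseteq>W. card X = h \<longrightarrow> (\<forall>j\<in>J. c X j = c0 X j))"
proof -
  define m where "m = card W"
  have m: "1 \<le> m" using W by (simp add: m_def Suc_le_eq card_gt_0_iff)
  define s where "s = n - m"
  have "m \<le> h * m" using h by simp
  also have "\<dots> \<le> n" using hm by (simp add: m_def)
  finally have n: "n = m + s" by (simp add: s_def)
  \<comment> \<open>The target of the stage that has colored exactly the traces of size at least
    \<open>i\<close>.\<close>
  define q where "q = (\<lambda>i X. if i \<le> card (X :: 'a set) then trace_mult l h s (card X) else 0)"
  have deg_q: "(\<Sum>X | X \<subseteq> W \<and> x \<in> X. q i X)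
      = l * (\<Sum>t=i-1..h-1. ((m - 1) choose t) * (s choose (h - 1 - t)))" if "x \<in> W" "1 \<le> i" for x i
    using sum_trace_mult_containing[OF W(1) that h] by (simp add: q_def m_def)
  have sm: "s + (m - 1) = n - 1" using m n by simp
  have tail: "i * (\<Sum>t=i-1..h-1. ((m - 1) choose t) * (s choose (h - 1 - t))) \<le> (n - 1) choose (h - 1)"
    if "1 \<le> i" for i
  proof -
    have "(h - 1) * (m - 1) + (h - 1) = h * m - m"
      using h m by (cases m; cases h) auto
    also have "\<dots> \<le> s" using hm by (simp add: s_def m_def)
    finally show ?thesis
      using hypergeometric_tail_bound[of "h - 1" "m - 1" s "i - 1"] half that sm
      by (simp add: s_def m_def)
  qed
  have "\<exists>c. (\<forall>X\<subseteq>W. (\<Sum>j\<in>J. c X j) = q 1 X) \<and>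
    (\<forall>x\<in>W. \<forall>j\<in>J. (\<Sum>X | X \<subseteq> W \<and> x \<in> X. c X j) \<le> r j) \<and>
    (\<forall>X\<subseteq>W. card X = h \<longrightarrow> (\<forall>j\<in>J. c X j = c0 X j))"
    using h
  \<comment> \<open>Downward from \<open>i = h\<close>, where \<open>c0\<close> already meets the
    target, to \<open>i = 1\<close>.\<close>
  proof (induction rule: inc_induct)
    case base
    have "(\<Sum>j\<in>J. c0 X j) = q h X" if "X \<subseteq> W" for X
      using c0 that by (auto simp: q_def trace_mult_def)
    with deg0 show ?case by blast
  next
    case (step i)
    then obtain c where c: "\<forall>X\<subseteq>W. (\<Sum>j\<in>J. c X j) = q (Suc i) X"
      "\<forall>x\<in>W. \<forall>j\<in>J. (\<Sum>X | X \<subseteq> W \<and> x \<in> X. c X j) \<le> r j"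
      "\<forall>X\<subseteq>W. card X = h \<longrightarrow> (\<forall>j\<in>J. c X j = c0 X j)" by blast
    have "\<exists>c'. (\<forall>X j. c X j \<le> c' X j) \<and> (\<forall>X\<subseteq>W. (\<Sum>j\<in>J. c' X j) = q i X) \<and>
      (\<forall>x\<in>W. \<forall>j\<in>J. (\<Sum>X | X \<subseteq> W \<and> x \<in> X. c' X j) \<le> r j)"
    proof (rule greedy_fill[OF W(1) J _ c(2)])
      show "\<forall>X\<subseteq>W. (\<Sum>j\<in>J. c X j) \<le> q i X" using c(1) by (simp add: q_def)
      show "\<forall>X\<subseteq>W. (\<Sum>j\<in>J. c X j) < q i X \<longrightarrow>
        X \<noteq> {} \<and> (\<Sum>x\<in>X. \<Sum>Y | Y \<subseteq> W \<and> x \<in> Y. q i Y) \<le> (\<Sum>j\<in>J. r j)"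
      proof (intro allI impI)
        fix X assume X: "X \<subseteq> W" "(\<Sum>j\<in>J. c X j) < q i X"
        \<comment> \<open>The targets \<open>q (Suc i)\<close> and \<open>q i\<close> differ only at
          size \<open>i\<close>.\<close>
        then have card: "card X = i" using c(1) by (auto simp: q_def split: if_splits)
        have "(\<Sum>x\<in>X. \<Sum>Y | Y \<subseteq> W \<and> x \<in> Y. q i Y)
          = (\<Sum>x\<in>X. l * (\<Sum>t=i-1..h-1. ((m - 1) choose t) * (s choose (h - 1 - t))))"
          using X(1) step.hyps by (intro sum.cong refl deg_q) auto
        also have "\<dots> = l * (i * (\<Sum>t=i-1..h-1. ((m - 1) choose t) * (s choose (h - 1 - t))))"
          using card by simp
        also have "\<dots> \<le> (\<Sum>j\<in>J. r j)"
          unfolding r(1) using tail[OF step.hyps(1)] by (rule mult_le_mono2)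
        finally show "X \<noteq> {} \<and> (\<Sum>x\<in>X. \<Sum>Y | Y \<subseteq> W \<and> x \<in> Y. q i Y) \<le> (\<Sum>j\<in>J. r j)"
          using card step.hyps(1) by auto
      qed
    qed
    then obtain c' where c': "\<forall>X j. c X j \<le> c' X j" "\<forall>X\<subseteq>W. (\<Sum>j\<in>J. c' X j) = q i X"
      "\<forall>x\<in>W. \<forall>j\<in>J. (\<Sum>X | X \<subseteq> W \<and> x \<in> X. c' X j) \<le> r j" by blast
    have "c' X j = c0 X j" if X: "X \<subseteq> W" "card X = h" and j: "j \<in> J" for X j
    proof -
      \<comment> \<open>Traces of size \<open>h\<close> are full before this stage, and filling
        never removes a color, so nothing changes there.\<close>
      have "(\<Sum>j\<in>J. c X j) = (\<Sum>j\<in>J. c' X j)"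
        using c(1) c'(2) X step.hyps(2) by (simp add: q_def)
      then have "c X j = c' X j"
        using c'(1) j J by (intro sum_mono_inv[of "c X" J "c' X"]) auto
      with c(3) X j show ?thesis by simp
    qed
    with c'(2,3) show ?case by blast
  qed
  then obtain c where c: "\<forall>X\<subseteq>W. (\<Sum>j\<in>J. c X j) = q 1 X"
    "\<forall>x\<in>W. \<forall>j\<in>J. (\<Sum>X | X \<subseteq> W \<and> x \<in> X. c X j) \<le> r j"
    "\<forall>X\<subseteq>W. card X = h \<longrightarrow> (\<forall>j\<in>J. c X j = c0 X j)" by blast
  \<comment> \<open>Every edge at \<open>x\<close> has a nonempty trace and is now colored. The
    degrees of \<open>x\<close> in all colors thus add up to the sum of \<open>r\<close>, which
    forces equality in each color.\<close>
  have deg: "(\<Sum>X | X \<subseteq> W \<and> x \<in> X. c X j) = r j" if x: "x \<in> W" and j: "j \<in> J" for x j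
  proof -
    have "(\<Sum>j\<in>J. \<Sum>X | X \<subseteq> W \<and> x \<in> X. c X j) = (\<Sum>X | X \<subseteq> W \<and> x \<in> X. \<Sum>j\<in>J. c X j)"
      by (rule sum.swap)
    also have "\<dots> = (\<Sum>X | X \<subseteq> W \<and> x \<in> X. q 1 X)"
      using c(1) by (intro sum.cong) auto
    also have "\<dots> = l * (\<Sum>t\<le>h-1. ((m - 1) choose t) * (s choose (h - 1 - t)))"
      using deg_q[OF x, of 1] by (simp add: atMost_atLeast0)
    also have "\<dots> = (\<Sum>j\<in>J. r j)"
      unfolding vandermonde r(1) using sm by (simp add: add.commute)
    finally show ?thesis
      using c(2) x j J by (intro sum_mono_inv[of _ J r]) auto
  qed
  have c_empty: "c {} j = 0" if "j \<in> J" for j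
  proof -
    have "(\<Sum>j\<in>J. c {} j) = 0" using c(1) by (simp add: q_def)
    with that J show ?thesis by simp
  qed
  define B where "B = (\<lambda>j. \<Sum>X\<in>Pow W. c X j)"
  \<comment> \<open>A nonempty trace is counted by at least one of its vertices, so
    \<open>B j\<close> \<le> \<open>m * r j\<close>; now \<open>h * m\<close> \<le> \<open>n\<close>
    applies.\<close>
  have B_le: "B j \<le> r j * n div h" if j: "j \<in> J" for j
  proof -
    have "B j \<le> (\<Sum>X\<in>Pow W. card X * c X j)"
      unfolding B_def
    proof (rule sum_mono)
      fix X assume "X \<in> Pow W"
      then show "c X j \<le> card X * c X j"
        using c_empty[OF j] W(1) finite_subset[of X W] by (cases "X = {}") (auto simp: Suc_le_eq card_gt_0_iff)
    qed
    also have "\<dots> = m * r j"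
      using deg j by (simp add: sum_degrees[OF W(1), symmetric] m_def)
    finally have "h * B j \<le> h * m * r j" by simp
    also have "\<dots> \<le> n * r j" using hm by (simp add: m_def)
    finally show ?thesis using h by (simp add: less_eq_div_iff_mult_less_eq mult.commute)
  qed
  have tot: "(\<Sum>j\<in>J. r j * n div h) = l * (n choose h)"
  proof -
    have "h * (\<Sum>j\<in>J. r j * n div h) = (\<Sum>j\<in>J. r j) * n"
      unfolding sum_distrib_left sum_distrib_right using r(2) by (intro sum.cong) auto
    also have "\<dots> = l * (n * ((n - 1) choose (h - 1)))" using r(1) by simp
    also have "\<dots> = h * (l * (n choose h))"
      using binomial_absorption[of "h - 1" n] h by simp
    finally show ?thesis using h by simp
  qed
  \<comment> \<open>The empty trace receives what color \<open>j\<close> still lacks.\<close>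
  define c' where "c' = (\<lambda>X j. if X = {} then r j * n div h - B j else c X j)"
  have sum_c': "(\<Sum>X\<in>Pow W. c' X j) = r j * n div h" if j: "j \<in> J" for j
  proof -
    have P: "{} \<in> Pow W" "finite (Pow W)" using W(1) by auto
    have "(\<Sum>X\<in>Pow W - {{}}. c' X j) = (\<Sum>X\<in>Pow W - {{}}. c X j)"
      by (intro sum.cong) (auto simp: c'_def)
    also have "\<dots> = B j" using c_empty[OF j] by (simp add: B_def sum.remove[OF P(2,1)])
    finally show ?thesis using B_le[OF j] by (simp add: sum.remove[OF P(2,1)] c'_def)
  qed
  have "trace_factorization n h l J r W c'"
    unfolding trace_factorization_def
  proof (intro conjI ballI allI impI)
    fix X assume X: "X \<subseteq> W"
    show "(\<Sum>j\<in>J. c' X j) = trace_mult l h (n - card W) (card X)"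
    proof (cases "X = {}")
      case False
      then have "1 \<le> card X" using X W(1) finite_subset[of X W] by (auto simp: Suc_le_eq card_gt_0_iff)
      with False X c(1) show ?thesis by (simp add: c'_def q_def s_def m_def)
    next
      case True
      \<comment> \<open>The color sizes add up to the number of all edges; cancelling those that
        meet \<open>W\<close> leaves the multiplicity of the empty trace.\<close>
      have "(\<Sum>j\<in>J. c' {} j) + (\<Sum>j\<in>J. B j) = (\<Sum>j\<in>J. r j * n div h)"
        using B_le by (simp add: c'_def sum.distrib[symmetric])
      also have "\<dots> = (\<Sum>X\<in>Pow W. trace_mult l h s (card X))"
        unfolding tot s_def m_def using n by (intro sum_trace_mult[symmetric] W(1)) (simp add: m_def)
      also have "\<dots> = trace_mult l h s 0 + (\<Sum>X\<in>Pow W. q 1 X)"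
      proof -
        have P: "{} \<in> Pow W" "finite (Pow W)" using W(1) by auto
        have "(\<Sum>X\<in>Pow W - {{}}. q 1 X) = (\<Sum>X\<in>Pow W - {{}}. trace_mult l h s (card X))"
        proof (rule sum.cong)
          fix X assume "X \<in> Pow W - {{}}"
          then have "1 \<le> card X" using W(1) finite_subset[of X W] by (auto simp: Suc_le_eq card_gt_0_iff)
          then show "q 1 X = trace_mult l h s (card X)" by (simp add: q_def)
        qed simp
        then show ?thesis by (simp add: sum.remove[OF P(2,1)] q_def)
      qed
      also have "(\<Sum>X\<in>Pow W. q 1 X) = (\<Sum>j\<in>J. B j)"
        unfolding B_def using c(1) by (subst sum.swap) simp
      finally show ?thesis using True by (simp add: s_def m_def)
    qed
  next
    fix x j assume "x \<in> W" "j \<in> J"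
    moreover have "(\<Sum>X | X \<subseteq> W \<and> x \<in> X. c' X j) = (\<Sum>X | X \<subseteq> W \<and> x \<in> X. c X j)"
      by (intro sum.cong) (auto simp: c'_def)
    ultimately show "(\<Sum>X | X \<subseteq> W \<and> x \<in> X. c' X j) = r j" using deg by simp
  next
    fix j assume "j \<in> J"
    then show "h * (\<Sum>X\<in>Pow W. c' X j) = r j * n" using sum_c' r(2) by simp
  qed
  moreover have "\<forall>X\<subseteq>W. card X = h \<longrightarrow> (\<forall>j\<in>J. c' X j = c0 X j)"
    using c(3) h by (auto simp: c'_def)
  ultimately show ?thesis by blast
qed

subsection \<open>Colorings of complete hypergraphs\<close>

text \<open>Degrees do not depend on which copies of an edge have a color, only on how many. The
  value 0 off \<open>h\<close>-sets makes this comparable with the functions \<open>c\<close> on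
  traces.\<close>

definition color_count :: "nat \<Rightarrow> nat \<Rightarrow> ('a set \<times> nat \<Rightarrow> 'b) \<Rightarrow> 'a set \<Rightarrow> 'b \<Rightarrow> nat" where
  "color_count l h f X j = (if card X = h then card {i. i < l \<and> f (X, i) = j} else 0)"

lemma verts_complete_hypergraph: "verts (complete_hypergraph l h V) = V"
  by (simp add: complete_hypergraph_def)

lemma verts_color_class: "verts (color_class G f j) = verts G"
  by (simp add: color_class_def)

lemma edge_copies_complete:
  assumes "finite V"
  shows "edge_copies (complete_hypergraph l h V) = {X. X \<subseteq> V \<and> card X = h} \<times> {..<l}"
  using assms by (auto simp: edge_copies_def count_complete_hypergraph split: if_splits)

lemma degree_color_class_complete:
  assumes "finite V"
  shows "degree (color_class (complete_hypergraph l h V) f j) x =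
    (\<Sum>X | X \<subseteq> V \<and> x \<in> X. color_count l h f X j)"
proof -
  define S where "S = {c \<in> edge_copies (complete_hypergraph l h V). f c = j}"
  have "finite S" using assms by (simp add: S_def edge_copies_complete)
  then have "degree (color_class (complete_hypergraph l h V) f j) x = card {c \<in> S. x \<in> fst c}"
    by (simp add: degree_def color_class_def S_def[symmetric] filter_mset_image_mset)
  also have "{c \<in> S. x \<in> fst c} = (SIGMA X:{X. X \<subseteq> V \<and> x \<in> X \<and> card X = h}. {i. i < l \<and> f (X, i) = j})"
    using assms by (auto simp: S_def edge_copies_complete)
  also have "card \<dots> = (\<Sum>X | X \<subseteq> V \<and> x \<in> X \<and> card X = h. card {i. i < l \<and> f (X, i) = j})"
    using assms by (intro card_SigmaI) auto
  also have "\<dots> = (\<Sum>X | X \<subseteq> V \<and> x \<in> X. color_count l h f X j)"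
    using assms by (intro sum.mono_neutral_cong_left) (auto simp: color_count_def)
  finally show ?thesis .
qed

lemma sum_color_count:
  assumes "finite V" "edge_coloring k (complete_hypergraph l h V) f" "X \<subseteq> V"
  shows "(\<Sum>j = 1..k. color_count l h f X j) = (if card X = h then l else 0)"
proof (cases "card X = h")
  case True
  have "(\<Sum>j = 1..k. \<Sum>i\<in>{i \<in> {..<l}. f (X, i) = j}. (1::nat)) = (\<Sum>i<l. 1)"
    using assms True by (intro sum.group) (auto simp: edge_coloring_def edge_copies_complete Pi_iff)
  with True show ?thesis by (simp add: color_count_def)
qed (simp add: color_count_def)

text \<open>Turns color counts back into colors of the single copies of an edge.\<close>

lemma exists_coloring_with_counts:
  fixes c :: "'b \<Rightarrow> nat"
  assumes "finite J" "(\<Sum>j\<in>J. c j) = l"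
  shows "\<exists>g. (\<forall>i<l. g i \<in> J) \<and> (\<forall>j\<in>J. card {i. i < l \<and> g i = j} = c j)"
  using assms(2)
proof (induction l arbitrary: c)
  case 0
  with assms(1) show ?case by simp
next
  case (Suc l)
  then obtain j0 where j0: "j0 \<in> J" "0 < c j0"
    by (metis Zero_not_Suc gr0I sum.neutral)
  have "(\<Sum>j\<in>J. c j) = (\<Sum>j\<in>J. (c(j0 := c j0 - 1)) j) + 1"
    using assms(1) j0 by (simp add: sum.remove[OF assms(1) j0(1)])
  with Suc.prems obtain g where g: "\<forall>i<l. g i \<in> J"
    "\<forall>j\<in>J. card {i. i < l \<and> g i = j} = (c(j0 := c j0 - 1)) j"
    using Suc.IH[of "c(j0 := c j0 - 1)"] by auto
  show ?case
  proof (intro exI[of _ "g(l := j0)"] conjI ballI allI impI)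
    fix i assume "i < Suc l"
    then show "(g(l := j0)) i \<in> J" using g(1) j0(1) by (auto simp: less_Suc_eq)
  next
    fix j assume j: "j \<in> J"
    have "{i. i < Suc l \<and> (g(l := j0)) i = j} =
      (if j = j0 then insert l {i. i < l \<and> g i = j} else {i. i < l \<and> g i = j})"
      by (auto simp: less_Suc_eq)
    moreover have "Suc (card {i. i < l \<and> g i = j0}) = c j0" using g(2) j0 by simp
    ultimately show "card {i. i < Suc l \<and> (g(l := j0)) i = j} = c j" using g(2) j by simp
  qed
qed

section \<open>Necessity and sufficiency of admissibility\<close>

lemma factorization_imp_admissible:
  assumes V: "finite V" "V \<noteq> {}" and h: "1 \<le> h"
    and g: "factorization k r (complete_hypergraph l h V) g"
  shows "admissible (card V) h l k r"
proof -
  have deg: "(\<Sum>X | X \<subseteq> V \<and> x \<in> X. color_count l h g X j) = r j" if "x \<in> V" "j \<in> {1..k}" for x j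
    using g that by (simp add: factorization_def regular_def verts_color_class
        verts_complete_hypergraph degree_color_class_complete[OF V(1)])
  \<comment> \<open>The total degree of a color class is \<open>h\<close> times its number of
    edges.\<close>
  have "h dvd r j * card V" if j: "j \<in> {1..k}" for j
  proof -
    have "r j * card V = (\<Sum>X\<in>Pow V. card X * color_count l h g X j)"
      using deg j by (simp add: sum_degrees[OF V(1), symmetric])
    also have "\<dots> = (\<Sum>X\<in>Pow V. h * color_count l h g X j)"
      by (intro sum.cong) (auto simp: color_count_def)
    finally show ?thesis by (simp add: sum_distrib_left[symmetric])
  qed
  moreover have "(\<Sum>j = 1..k. r j) = l * ((card V - 1) choose (h - 1))"
  proof -
    obtain x where x: "x \<in> V" using V(2) by auto
    have col: "edge_coloring k (complete_hypergraph l h V) g" using g by (simp add: factorization_def)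
    have "(\<Sum>j = 1..k. r j) = (\<Sum>j = 1..k. \<Sum>X | X \<subseteq> V \<and> x \<in> X. color_count l h g X j)"
      using deg x by simp
    also have "\<dots> = (\<Sum>X | X \<subseteq> V \<and> x \<in> X. \<Sum>j = 1..k. color_count l h g X j)"
      by (rule sum.swap)
    \<comment> \<open>With no identified vertices, traces are edges, so the count of edges at a
      vertex by traces applies with \<open>s = 0\<close>.\<close>
    also have "\<dots> = (\<Sum>X | X \<subseteq> V \<and> x \<in> X. if 1 \<le> card X then trace_mult l h 0 (card X) else 0)"
      using sum_color_count[OF V(1) col] h by (intro sum.cong) (auto simp: trace_mult_def)
    also have "\<dots> = l * (\<Sum>t\<le>h-1. ((card V - 1) choose t) * (0 choose (h - 1 - t)))"
      using sum_trace_mult_containing[OF V(1) x _ h, of 1 l 0] by (simp add: atMost_atLeast0)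
    finally show ?thesis unfolding vandermonde by simp
  qed
  ultimately show ?thesis by (simp add: admissible_def)
qed

lemma extend_partial_factorization:
  assumes V: "finite V" "card V = n" and W: "W \<subseteq> V" "W \<noteq> {}" and h: "1 \<le> h"
    and hm: "h * card W \<le> n"
    and half: "(n - 1) choose (h - 1) \<le> 2 * ((n - card W) choose (h - 1))"
    and f: "partial_factorization k r (complete_hypergraph l h W) f"
    and adm: "admissible n h l k r"
  shows "\<exists>g. factorization k r (complete_hypergraph l h V) g \<and>
    extends_coloring (complete_hypergraph l h V) g (complete_hypergraph l h W) f"
proof -
  have finW: "finite W" using V W finite_subset by blast
  have col: "edge_coloring k (complete_hypergraph l h W) f"
    using f by (simp add: partial_factorization_def)
  have "\<exists>c. trace_factorization n h l {1..k} r W c \<and>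
    (\<forall>X\<subseteq>W. card X = h \<longrightarrow> (\<forall>j\<in>{1..k}. c X j = color_count l h f X j))"
  proof (rule trace_factorization_exists[OF h finW W(2) _ hm half])
    show "\<forall>x\<in>W. \<forall>j\<in>{1..k}. (\<Sum>X | X \<subseteq> W \<and> x \<in> X. color_count l h f X j) \<le> r j"
      using f by (simp add: partial_factorization_def degree_color_class_complete[OF finW]
          verts_complete_hypergraph)
  qed (use adm sum_color_count[OF finW col] in \<open>auto simp: admissible_def\<close>)
  then obtain cW where cW: "trace_factorization n h l {1..k} r W cW"
    "\<forall>X\<subseteq>W. card X = h \<longrightarrow> (\<forall>j\<in>{1..k}. cW X j = color_count l h f X j)" by blast
  have "n = card W + card (V - W)"
    using V W card_mono[OF V(1) W(1)] by (simp add: card_Diff_subset finW)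
  then obtain c where c: "trace_factorization n h l {1..k} r (W \<union> (V - W)) c"
    "\<forall>X\<subseteq>W. card X = h \<longrightarrow> (\<forall>j\<in>{1..k}. c X j = cW X j)"
    using trace_factorization_extend[OF _ finW _ _ _ cW(1), of "V - W"] V(1) by auto
  have "W \<union> (V - W) = V" using W by auto
  \<comment> \<open>All vertices are split off, and \<open>trace_mult l h 0 t\<close> is
    \<open>l\<close> for \<open>t = h\<close> and 0 otherwise: \<open>c\<close> now counts colors of
    true edges.\<close>
  then have c1: "\<forall>X\<subseteq>V. (\<Sum>j = 1..k. c X j) = trace_mult l h 0 (card X)"
    and c2: "\<forall>x\<in>V. \<forall>j\<in>{1..k}. (\<Sum>X | X \<subseteq> V \<and> x \<in> X. c X j) = r j"
    using c(1) V(2) by (simp_all add: trace_factorization_def)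
  have "\<exists>g. (\<forall>i<l. g i \<in> {1..k}) \<and> (\<forall>j\<in>{1..k}. card {i. i < l \<and> g i = j} = c X j)"
    if "X \<subseteq> V" "card X = h" for X
    using c1 that by (intro exists_coloring_with_counts) (auto simp: trace_mult_def)
  then obtain G where G: "\<forall>i<l. G X i \<in> {1..k}" "\<forall>j\<in>{1..k}. card {i. i < l \<and> G X i = j} = c X j"
    if "X \<subseteq> V" "card X = h" for X
    by metis
  \<comment> \<open>Inside \<open>W\<close> the counts of \<open>f\<close> were preserved
    throughout, so keeping \<open>f\<close> there is consistent with \<open>c\<close>.\<close>
  define g where "g = (\<lambda>(X, i). if X \<subseteq> W then f (X, i) else G X i)"
  have count: "color_count l h g X j = c X j" if X: "X \<subseteq> V" and j: "j \<in> {1..k}" for X j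
  proof (cases "card X = h")
    case True
    show ?thesis
    proof (cases "X \<subseteq> W")
      case True
      with \<open>card X = h\<close> c(2) cW(2) j show ?thesis by (simp add: color_count_def g_def)
    next
      case False
      with \<open>card X = h\<close> G(2)[OF X] j show ?thesis by (simp add: color_count_def g_def)
    qed
  next
    case False
    then have "(\<Sum>j = 1..k. c X j) = 0" using c1 X by (auto simp: trace_mult_def)
    then have "c X j = 0" using j by simp
    with False show ?thesis by (simp add: color_count_def)
  qed
  have "edge_coloring k (complete_hypergraph l h V) g"
    using col G(1) by (auto simp: edge_coloring_def edge_copies_complete[OF V(1)]
        edge_copies_complete[OF finW] g_def Pi_iff)
  moreover have "degree (color_class (complete_hypergraph l h V) g j) x = r j" if "x \<in> V" "j \<in> {1..k}" for x j
    using count c2 that by (simp add: degree_color_class_complete[OF V(1)])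
  ultimately have "factorization k r (complete_hypergraph l h V) g"
    by (simp add: factorization_def regular_def verts_color_class verts_complete_hypergraph)
  moreover have "extends_coloring (complete_hypergraph l h V) g (complete_hypergraph l h W) f"
    using subhypergraph_complete[OF V(1) W(1)]
    by (auto simp: extends_coloring_def edge_copies_complete[OF finW] g_def)
  ultimately show ?thesis by blast
qed

theorem theorem1p1:
  fixes h m n l k :: nat and r :: "nat \<Rightarrow> nat" and V W :: "'a set"
  assumes "h \<ge> 2" and "m \<ge> 1" and "n \<ge> 1" and "l \<ge> 1"
    and "real n > (real m - 1) / (1 - 2 powr (1 / (1 - real h))) + real h - 1"
    and "finite V" and "card V = n" and "W \<subseteq> V" and "card W = m"
  shows "\<forall>f. partial_factorization k r (complete_hypergraph l h W) f \<longrightarrow>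
           ((\<exists>g. factorization k r (complete_hypergraph l h V) g \<and>
                 extends_coloring (complete_hypergraph l h V) g (complete_hypergraph l h W) f)
            \<longleftrightarrow> admissible n h l k r)"
proof (intro allI impI iffI)
  fix f
  assume "\<exists>g. factorization k r (complete_hypergraph l h V) g \<and>
    extends_coloring (complete_hypergraph l h V) g (complete_hypergraph l h W) f"
  then obtain g where "factorization k r (complete_hypergraph l h V) g" by blast
  moreover have "V \<noteq> {}" "1 \<le> h" using assms by auto
  ultimately show "admissible n h l k r"
    using factorization_imp_admissible assms by metis
next
  fix f
  assume f: "partial_factorization k r (complete_hypergraph l h W) f" and adm: "admissible n h l k r"
  have "W \<noteq> {}" "1 \<le> h" using assms by auto
  then show "\<exists>g. factorization k r (complete_hypergraph l h V) g \<and>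
    extends_coloring (complete_hypergraph l h V) g (complete_hypergraph l h W) f"
    using size_bound_consequences[OF assms(1,2,5)] assms(6-9) f adm
    by (intro extend_partial_factorization) auto
qed

end
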